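(* Let $\mathbb{F}\in\{\mathbb{R},\mathbb{C}\}$. Let $\mathbb{S}$ be an $l^2/m$-cohesive collection of subsets of $\{1,\dots,m\}$, each of size $l$; let $\{\mathcal{B}_k\}_{k\in K}$ be a set of mutually unbiased bases for $\mathbb{F}^m$ with $\mathcal{B}_k=\{b^{(k)}_j\}_{j=1}^m$ and $|K|\,|\mathbb{S}|>d_{\mathbb{F}}(m)+1$; and let $n=|K|\,|\mathbb{S}|$. If $\mathcal{F}=\{P^{(k)}_{\mathcal{J}}:k\in K,\ \mathcal{J}\in\mathbb{S}\}$ forms an $(n,l,m)$-fusion frame, where $P^{(k)}_{\mathcal{J}}$ is the $\mathcal{J}$-coordinate projection with respect to $\mathcal{B}_k$, then $\mathcal{F}$ is an orthoplex-bound achieving $(n,l,m)$-fusion frame. Moreover, if $\mathbb{S}$ is maximally orthoplectic and $|K|=k_{\mathbb{F}}(m)$, then $\mathcal{F}$ is a tight, maximal orthoplectic fusion frame.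
   Context: An $(n,l,m)$-fusion frame is a set $\{P_j\}_{j=1}^n$ of orthogonal projections onto $l$-dimensional subspaces of $\mathbb{F}^m$ with $A\|x\|^2\le\sum_j\|P_jx\|^2\le B\|x\|^2$ for some $0<A\le B$ and all $x$; it is tight if one can take $A=B$. Let $d_{\mathbb{F}}(m)=\frac{(m+2)(m-1)}{2}$ if $\mathbb{F}=\mathbb{R}$, $d_{\mathbb{F}}(m)=m^2-1$ if $\mathbb{F}=\mathbb{C}$; $k_{\mathbb{R}}(m)=m/2+1$, $k_{\mathbb{C}}(m)=m+1$. A fusion frame is Grassmannian if it minimizes $\max_{j\ne k}\mathrm{tr}(P_jP_k)$ among all $(n,l,m)$-fusion frames; orthoplex-bound achieving if it is Grassmannian, $n>d_{\mathbb{F}}(m)+1$ and $\max_{j\ne k}\mathrm{tr}(P_jP_k)=l^2/m$; maximal orthoplectic if moreover $n=2d_{\mathbb{F}}(m)$. Orthonormal bases are mutually unbiased if $|\langle b_j,b'_{j'}\rangle|^2=1/m$ for all $j,j'$; a set of mutually unbiased bases is one whose members are pairwise mutually unbiased. The $\mathcal{J}$-coordinate projection with respect to an orthonormal basis $\{b_j\}$ is $\sum_{j\in\mathcal{J}}b_j\otimes b_j^*$. A collection $\mathbb{S}$ of subsets of $\{1,\dots,m\}$, each of size $l$, is $c$-cohesive if $\max_{\mathcal{J}\ne\mathcal{J}'\in\mathbb{S}}|\mathcal{J}\cap\mathcal{J}'|\le c$; it is maximally orthoplectic if it is $l^2/m$-cohesive and $|\mathbb{S}|=2(m-1)$. *)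

theory Defs
  imports "HOL-Analysis.Analysis"
begin

text \<open>The scalar field F: if rf is True then F = R (embedded in C), otherwise F = C.
  Vectors of F^m are represented as complex^'m with all entries in F, m = CARD('m).\<close>

definition scalars :: "bool \<Rightarrow> complex set" where
  "scalars rf = (if rf then \<real> else UNIV)"

definition Fvec :: "bool \<Rightarrow> (complex^'m) set" where
  "Fvec rf = {x. \<forall>i. x $ i \<in> scalars rf}"

definition Fmat :: "bool \<Rightarrow> (complex^'m^'m) set" where
  "Fmat rf = {A. \<forall>i j. A $ i $ j \<in> scalars rf}"

definition cinner :: "complex^'m \<Rightarrow> complex^'m \<Rightarrow> complex" where
  "cinner x y = (\<Sum>i\<in>UNIV. x $ i * cnj (y $ i))"

definition adjoint_mat :: "complex^'m^'m \<Rightarrow> complex^'m^'m" where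
  "adjoint_mat A = (\<chi> i j. cnj (A $ j $ i))"

definition orth_proj :: "bool \<Rightarrow> nat \<Rightarrow> complex^'m^'m \<Rightarrow> bool" where
  "orth_proj rf l P \<longleftrightarrow> P \<in> Fmat rf \<and> P ** P = P \<and> adjoint_mat P = P \<and> rank P = l"

definition fusion_frame :: "bool \<Rightarrow> nat \<Rightarrow> nat \<Rightarrow> 'i set \<Rightarrow> ('i \<Rightarrow> complex^'m^'m) \<Rightarrow> bool" where
  "fusion_frame rf n l I P \<longleftrightarrow> finite I \<and> card I = n \<and> (\<forall>j\<in>I. orth_proj rf l (P j)) \<and>
     (\<exists>A B. 0 < A \<and> A \<le> B \<and> (\<forall>x\<in>Fvec rf.
        A * (norm x)^2 \<le> (\<Sum>j\<in>I. (norm (P j *v x))^2) \<and>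
        (\<Sum>j\<in>I. (norm (P j *v x))^2) \<le> B * (norm x)^2))"

definition tight_fusion_frame :: "bool \<Rightarrow> nat \<Rightarrow> nat \<Rightarrow> 'i set \<Rightarrow> ('i \<Rightarrow> complex^'m^'m) \<Rightarrow> bool" where
  "tight_fusion_frame rf n l I P \<longleftrightarrow> fusion_frame rf n l I P \<and>
     (\<exists>A>0. \<forall>x\<in>Fvec rf. (\<Sum>j\<in>I. (norm (P j *v x))^2) = A * (norm x)^2)"

text \<open>max over j \<noteq> k of tr(P_j P_k) (real-valued for orthogonal projections).\<close>
definition max_tr :: "'i set \<Rightarrow> ('i \<Rightarrow> complex^'m^'m) \<Rightarrow> real" where
  "max_tr I P = Max {Re (trace (P j ** P k)) | j k. j \<in> I \<and> k \<in> I \<and> j \<noteq> k}"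

text \<open>Grassmannian: minimizes max_tr among all (n,l,m)-fusion frames (with n = card I);
  competitors are indexed by {..<n}, which loses no generality.\<close>
definition grassmannian :: "bool \<Rightarrow> nat \<Rightarrow> nat \<Rightarrow> 'i set \<Rightarrow> ('i \<Rightarrow> complex^'m^'m) \<Rightarrow> bool" where
  "grassmannian rf n l I P \<longleftrightarrow> fusion_frame rf n l I P \<and>
     (\<forall>Q :: nat \<Rightarrow> complex^'m^'m. fusion_frame rf n l {..<n} Q \<longrightarrow> max_tr I P \<le> max_tr {..<n} Q)"

definition dF :: "bool \<Rightarrow> nat \<Rightarrow> nat" where
  "dF rf m = (if rf then (m + 2) * (m - 1) div 2 else m^2 - 1)"

definition kF :: "bool \<Rightarrow> nat \<Rightarrow> real" where
  "kF rf m = (if rf then real m / 2 + 1 else real m + 1)"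

definition orthoplex_bound_achieving :: "bool \<Rightarrow> nat \<Rightarrow> nat \<Rightarrow> 'i set \<Rightarrow> ('i \<Rightarrow> complex^'m^'m) \<Rightarrow> bool" where
  "orthoplex_bound_achieving rf n l I P \<longleftrightarrow> grassmannian rf n l I P \<and>
     n > dF rf CARD('m) + 1 \<and> max_tr I P = real l ^ 2 / real CARD('m)"

definition maximal_orthoplectic :: "bool \<Rightarrow> nat \<Rightarrow> nat \<Rightarrow> 'i set \<Rightarrow> ('i \<Rightarrow> complex^'m^'m) \<Rightarrow> bool" where
  "maximal_orthoplectic rf n l I P \<longleftrightarrow> orthoplex_bound_achieving rf n l I P \<and>
     n = 2 * dF rf CARD('m)"

definition onb :: "bool \<Rightarrow> ('m \<Rightarrow> complex^'m) \<Rightarrow> bool" where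
  "onb rf b \<longleftrightarrow> (\<forall>j. b j \<in> Fvec rf) \<and> (\<forall>j j'. cinner (b j) (b j') = (if j = j' then 1 else 0))"

definition mutually_unbiased :: "('m \<Rightarrow> complex^'m) \<Rightarrow> ('m \<Rightarrow> complex^'m) \<Rightarrow> bool" where
  "mutually_unbiased b b' \<longleftrightarrow> (\<forall>j j'. (cmod (cinner (b j) (b' j')))^2 = 1 / real CARD('m))"

definition MUB_set :: "bool \<Rightarrow> 'k set \<Rightarrow> ('k \<Rightarrow> 'm \<Rightarrow> complex^'m) \<Rightarrow> bool" where
  "MUB_set rf K B \<longleftrightarrow> (\<forall>k\<in>K. onb rf (B k)) \<and>
     (\<forall>k\<in>K. \<forall>k'\<in>K. k \<noteq> k' \<longrightarrow> mutually_unbiased (B k) (B k'))"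

definition outer :: "complex^'m \<Rightarrow> complex^'m^'m" where
  "outer b = (\<chi> i i'. b $ i * cnj (b $ i'))"

definition coord_proj :: "('m \<Rightarrow> complex^'m) \<Rightarrow> 'm set \<Rightarrow> complex^'m^'m" where
  "coord_proj b J = (\<Sum>j\<in>J. outer (b j))"

definition cohesive :: "real \<Rightarrow> 'm set set \<Rightarrow> bool" where
  "cohesive c S \<longleftrightarrow> (\<forall>J\<in>S. \<forall>J'\<in>S. J \<noteq> J' \<longrightarrow> real (card (J \<inter> J')) \<le> c)"

definition max_orthoplectic_coll :: "nat \<Rightarrow> 'm set set \<Rightarrow> bool" where
  "max_orthoplectic_coll l S \<longleftrightarrow> cohesive (real l ^ 2 / real CARD('m)) S \<and>
     card S = 2 * (CARD('m) - 1)"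

end

theory Submission
  imports Defs
begin

text \<open>
  Subtracting \<open>(l/m) I\<close> sends rank-\<open>l\<close> projections to traceless Hermitian matrices, a real inner
  product space of dimension \<open>dF\<close>, where the inner product of two images is \<open>tr (P Q) - l\<^sup>2/m\<close>.
  By Rankin, at most \<open>d + 1\<close> vectors in dimension \<open>d\<close> have pairwise negative inner products, so
  more than \<open>dF + 1\<close> projections have some \<open>tr (P Q) \<ge> l\<^sup>2/m\<close>. For coordinate projections,
  \<open>tr (P Q)\<close> equals \<open>l\<^sup>2/m\<close> across unbiased bases and is the size of an intersection within one
  basis, hence cohesiveness gives equality.

  For tightness, the centred indicator vectors of \<open>S\<close> are \<open>2 (m - 1)\<close> vectors of equal norm in
  dimension \<open>m - 1\<close> with pairwise nonpositive inner products. The equality case of Rankin's second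
  bound says that they come in antipodal pairs, so they sum to zero. Every coordinate is then
  covered equally often, and within each basis the projections sum to a multiple of the identity.
\<close>

subsection \<open>Rankin's bounds\<close>

text \<open>The component of \<open>w\<close> orthogonal to \<open>v\<close>. For
  \<open>v = 0\<close> the quotient is 0 and the component is \<open>w\<close> itself, so the inner
  product identities below hold for every \<open>v\<close>.\<close>

definition perp_part :: "'a::real_inner \<Rightarrow> 'a \<Rightarrow> 'a" where
  "perp_part v w = w - (w \<bullet> v / (v \<bullet> v)) *\<^sub>R v"

lemma perp_part_inner_self: "perp_part v w \<bullet> v = 0"
  by (cases "v = 0") (simp_all add: perp_part_def inner_diff_left)

text \<open>The projected vector is orthogonal to \<open>v\<close>, so only one correction term
  survives. That term is nonnegative when \<open>w\<close> and \<open>u\<close> both have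
  nonpositive inner product with \<open>v\<close>; projecting then never increases their inner
  product, which drives both inductions below.\<close>

lemma inner_perp_part: "perp_part v w \<bullet> perp_part v u = w \<bullet> u - (w \<bullet> v) * (u \<bullet> v) / (v \<bullet> v)"
proof -
  have "perp_part v w \<bullet> perp_part v u = perp_part v w \<bullet> u"
    by (subst (2) perp_part_def) (simp add: inner_diff_right perp_part_inner_self)
  also have "\<dots> = w \<bullet> u - (w \<bullet> v) * (u \<bullet> v) / (v \<bullet> v)"
    by (simp add: perp_part_def inner_diff_left inner_commute[of v u])
  finally show ?thesis .
qed

text \<open>A vector orthogonal to \<open>X\<close> is orthogonal to its span, and a nonzero vector
  is not orthogonal to itself. Later this counts the identity matrix and the all-ones vector as an
  extra dimension.\<close>

lemma dim_orthogonal_insert: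
  fixes v :: "'a::euclidean_space"
  assumes "v \<noteq> 0" "\<And>x. x \<in> X \<Longrightarrow> x \<bullet> v = 0"
  shows "dim (insert v X) = Suc (dim X)"
proof -
  have "x \<bullet> v = 0" if "x \<in> span X" for x
    using that assms(2) by (induction rule: span_induct_alt) (auto simp: inner_add_left)
  then have "v \<notin> span X" using assms(1) by force
  then show ?thesis by (simp add: dim_insert)
qed

text \<open>The projected vectors are orthogonal to \<open>v\<close> and together with
  \<open>v\<close> still lie in the span of \<open>X\<close>.\<close>

lemma dim_perp_part_image:
  fixes v :: "'a::euclidean_space"
  assumes "v \<in> X" "v \<noteq> 0"
  shows "Suc (dim (perp_part v ` (X - {v}))) \<le> dim X"
proof -
  have "Suc (dim (perp_part v ` (X - {v}))) = dim (insert v (perp_part v ` (X - {v})))"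
    using assms(2) by (intro dim_orthogonal_insert[symmetric]) (auto simp: perp_part_inner_self)
  also have "\<dots> \<le> dim X"
    using assms(1) by (intro dim_mono) (auto simp: perp_part_def intro: span_diff span_scale span_base)
  finally show ?thesis .
qed

text \<open>Induction on the cardinality: remove a member \<open>v\<close> and project the others
  onto its orthogonal complement. Inner products stay negative, one vector is lost, and the
  dimension drops by at least one.\<close>

lemma card_le_dim_if_inner_neg:
  fixes X :: "'a::euclidean_space set"
  assumes "finite X" "pairwise (\<lambda>x y. x \<bullet> y < 0) X"
  shows "card X \<le> dim X + 1"
  using assms
proof (induction "card X" arbitrary: X)
  case (Suc n)
  then obtain v where v: "v \<in> X" by fastforce
  show ?case
  proof (cases "v = 0")
    case True
    then have "X = {v}" using Suc.prems(2) v by (auto simp: pairwise_def)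
    then show ?thesis by simp
  next
    case False
    let ?X' = "perp_part v ` (X - {v})"
    have neg: "perp_part v x \<bullet> perp_part v y < 0" if "x \<in> X - {v}" "y \<in> X - {v}" "x \<noteq> y" for x y
    proof -
      have "x \<bullet> v < 0" "y \<bullet> v < 0" "x \<bullet> y < 0"
        using that v Suc.prems(2) by (auto simp: pairwise_def)
      then have "0 \<le> (x \<bullet> v) * (y \<bullet> v) / (v \<bullet> v)"
        by (intro divide_nonneg_nonneg mult_nonpos_nonpos) auto
      with \<open>x \<bullet> y < 0\<close> show ?thesis by (simp add: inner_perp_part)
    qed
    \<comment> \<open>Two distinct vectors with the same image would give that image a negative
      square.\<close>
    have inj: "inj_on (perp_part v) (X - {v})"
      by (rule inj_onI) (metis neg inner_ge_zero not_le)
    have "pairwise (\<lambda>x y. x \<bullet> y < 0) ?X'"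
      using neg by (auto simp: pairwise_def)
    moreover have "card ?X' = n"
      using Suc.hyps(2) Suc.prems(1) v by (simp add: card_image[OF inj])
    ultimately have "n \<le> dim ?X' + 1"
      using Suc.hyps(1)[of ?X'] Suc.prems(1) by simp
    with dim_perp_part_image[OF v False] Suc.hyps(2) show ?thesis by simp
  qed
qed simp

section \<open>Nonpositive inner products: Rankin's second bound and its equality case\<close>

lemma perp_part_eq_0_iff:
  assumes "v \<noteq> 0" shows "perp_part v w = 0 \<longleftrightarrow> (\<exists>c. w = c *\<^sub>R v)"
  using assms by (auto simp: perp_part_def)

text \<open>Multiples of \<open>v\<close> are sent to 0 and are excluded from \<open>Y\<close>. On
  \<open>Y\<close> the projection is injective, since an image shared by two vectors would have
  nonpositive square and thus be 0.\<close>

lemma perp_part_image_nonpos: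
  fixes X :: "'a::euclidean_space set"
  assumes nz: "0 \<notin> X" and np: "pairwise (\<lambda>x y. x \<bullet> y \<le> 0) X" and v: "v \<in> X"
    and Y: "Y = {x \<in> X - {v}. perp_part v x \<noteq> 0}"
  shows "inj_on (perp_part v) Y" "pairwise (\<lambda>x y. x \<bullet> y \<le> 0) (perp_part v ` Y)"
proof -
  have neg: "perp_part v x \<bullet> perp_part v y \<le> 0" if "x \<in> Y" "y \<in> Y" "x \<noteq> y" for x y
  proof -
    have "x \<bullet> v \<le> 0" "y \<bullet> v \<le> 0" "x \<bullet> y \<le> 0"
      using that v np Y by (auto simp: pairwise_def)
    then have "0 \<le> (x \<bullet> v) * (y \<bullet> v) / (v \<bullet> v)"
      by (intro divide_nonneg_nonneg mult_nonpos_nonpos) auto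
    with \<open>x \<bullet> y \<le> 0\<close> show ?thesis by (simp add: inner_perp_part)
  qed
  show "inj_on (perp_part v) Y"
  proof (rule inj_onI, rule ccontr)
    fix x y assume "x \<in> Y" "y \<in> Y" "perp_part v x = perp_part v y" "x \<noteq> y"
    then have "perp_part v x \<bullet> perp_part v x \<le> 0" using neg[of x y] by simp
    then have "perp_part v x = 0" by (metis inner_eq_zero_iff inner_ge_zero order_antisym)
    then show False using \<open>x \<in> Y\<close> Y by simp
  qed
  show "pairwise (\<lambda>x y. x \<bullet> y \<le> 0) (perp_part v ` Y)"
    using neg by (auto simp: pairwise_def)
qed

lemma negative_multiple:
  fixes v :: "'a::real_inner"
  assumes "v \<noteq> 0" "w \<noteq> 0" "w \<bullet> v \<le> 0" "perp_part v w = 0"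
  obtains c where "c < 0" "w = c *\<^sub>R v"
proof -
  obtain c where c: "w = c *\<^sub>R v" using assms perp_part_eq_0_iff by blast
  have "0 < v \<bullet> v" using assms by simp
  moreover have "c * (v \<bullet> v) \<le> 0" using assms(3) c by simp
  ultimately have "c \<le> 0" by (meson mult_pos_pos not_le)
  moreover have "c \<noteq> 0" using assms(2) c by auto
  ultimately show ?thesis using c that by force
qed

text \<open>Induction on the dimension. Projecting along \<open>v\<close> loses \<open>v\<close> and
  the members in \<open>Z\<close>, which are negative multiples of \<open>v\<close>. Two of these
  would have positive inner product, so at most two vectors are lost per dimension.\<close>

lemma card_le_twice_dim_if_inner_nonpos:
  fixes X :: "'a::euclidean_space set"
  assumes "finite X" "0 \<notin> X" "pairwise (\<lambda>x y. x \<bullet> y \<le> 0) X"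
  shows "card X \<le> 2 * dim X"
  using assms
proof (induction "dim X" arbitrary: X rule: less_induct)
  case less
  show ?case
  proof (cases "X = {}")
    case False
    then obtain v where v: "v \<in> X" by blast
    then have v0: "v \<noteq> 0" using less.prems by auto
    define Y where "Y = {x \<in> X - {v}. perp_part v x \<noteq> 0}"
    define Z where "Z = {x \<in> X - {v}. perp_part v x = 0}"
    have "dim (perp_part v ` Y) \<le> dim (perp_part v ` (X - {v}))"
      by (rule dim_subset) (auto simp: Y_def)
    with dim_perp_part_image[OF v v0] have dY: "Suc (dim (perp_part v ` Y)) \<le> dim X" by simp
    have "card (perp_part v ` Y) \<le> 2 * dim (perp_part v ` Y)"
      using dY perp_part_image_nonpos(2)[OF less.prems(2,3) v Y_def] less.prems(1)
      by (intro less.hyps) (auto simp: Y_def)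
    moreover have "card (perp_part v ` Y) = card Y"
      by (rule card_image[OF perp_part_image_nonpos(1)[OF less.prems(2,3) v Y_def]])
    moreover have "card Z \<le> 1"
    proof -
      have "x = y" if xy: "x \<in> Z" "y \<in> Z" for x y
      proof (rule ccontr)
        assume "x \<noteq> y"
        have "x \<bullet> v \<le> 0" "y \<bullet> v \<le> 0" "x \<bullet> y \<le> 0" "x \<noteq> 0" "y \<noteq> 0"
          using xy v less.prems(2,3) \<open>x \<noteq> y\<close> by (auto simp: Z_def pairwise_def)
        moreover obtain c where "c < 0" "x = c *\<^sub>R v"
          using negative_multiple[of v x] v0 calculation xy by (auto simp: Z_def)
        moreover obtain d where "d < 0" "y = d *\<^sub>R v"
          using negative_multiple[of v y] v0 calculation xy by (auto simp: Z_def)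
        moreover have "0 < v \<bullet> v" using v0 by simp
        ultimately have "0 < x \<bullet> y" by (simp add: mult_neg_neg mult.assoc[symmetric])
        with \<open>x \<bullet> y \<le> 0\<close> show False by simp
      qed
      moreover have "finite Z" using less.prems(1) by (simp add: Z_def)
      ultimately show ?thesis by (simp add: card_le_Suc0_iff_eq)
    qed
    moreover have "card X = Suc (card Y + card Z)"
    proof -
      have "X = insert v (Y \<union> Z)" "v \<notin> Y \<union> Z" "Y \<inter> Z = {}" "finite Y" "finite Z"
        using v less.prems(1) by (auto simp: Y_def Z_def)
      then show ?thesis by (metis card_Un_disjoint card_insert_disjoint finite_UnI)
    qed
    ultimately show ?thesis using dY by linarith
  qed simp
qed

text \<open>If no other member is a multiple of \<open>v\<close>, projecting along \<open>v\<close> loses one vector but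
  allows for two fewer.\<close>

lemma negative_multiple_if_card_extremal:
  fixes X :: "'a::euclidean_space set"
  assumes fin: "finite X" and nz: "0 \<notin> X" and np: "pairwise (\<lambda>x y. x \<bullet> y \<le> 0) X"
    and card: "card X \<ge> 2 * dim X" and v: "v \<in> X"
  shows "\<exists>c<0. c *\<^sub>R v \<in> X"
proof (rule ccontr)
  assume no: "\<not> ?thesis"
  have v0: "v \<noteq> 0" using v nz by auto
  have npr: "perp_part v x \<noteq> 0" if "x \<in> X - {v}" for x
  proof
    assume "perp_part v x = 0"
    moreover have "x \<bullet> v \<le> 0" "x \<noteq> 0" using that v nz np by (auto simp: pairwise_def)
    ultimately obtain c where "c < 0" "x = c *\<^sub>R v" using negative_multiple v0 by blast
    then show False using no that by auto
  qed
  then have Y: "X - {v} = {x \<in> X - {v}. perp_part v x \<noteq> 0}" by auto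
  have "card (X - {v}) = card (perp_part v ` (X - {v}))"
    by (rule card_image[OF perp_part_image_nonpos(1)[OF nz np v Y], symmetric])
  also have "\<dots> \<le> 2 * dim (perp_part v ` (X - {v}))"
    using fin perp_part_image_nonpos(2)[OF nz np v Y] npr
    by (intro card_le_twice_dim_if_inner_nonpos) (simp, force, simp)
  finally have "card X - 1 \<le> 2 * dim (perp_part v ` (X - {v}))" using v fin by simp
  with dim_perp_part_image[OF v v0] card show False by linarith
qed

text \<open>Equal norms turn the negative multiple of \<open>v\<close> in \<open>X\<close> into
  \<open>- v\<close>. So \<open>X\<close> is closed under negation and its sum equals its own
  negative.\<close>

lemma sum_eq_0_if_card_extremal:
  fixes X :: "'a::euclidean_space set"
  assumes "finite X" "0 \<notin> X" "pairwise (\<lambda>x y. x \<bullet> y \<le> 0) X"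
    and "card X \<ge> 2 * dim X" and norm: "\<And>x. x \<in> X \<Longrightarrow> norm x = r"
  shows "\<Sum>X = 0"
proof -
  have neg: "- v \<in> X" if v: "v \<in> X" for v
  proof -
    obtain c where c: "c < 0" "c *\<^sub>R v \<in> X"
      using negative_multiple_if_card_extremal[OF assms(1-4) v] by blast
    have "v \<noteq> 0" using v assms(2) by auto
    moreover have "norm (c *\<^sub>R v) = norm v" using norm[OF c(2)] norm[OF v] by (simp only:)
    ultimately have "\<bar>c\<bar> = 1" by simp
    then have "c = -1" using c(1) by simp
    with c show ?thesis by simp
  qed
  have "\<Sum>X = (\<Sum>x\<in>X. - x)"
    by (rule sum.reindex_bij_witness[where i = uminus and j = uminus]) (auto simp: neg)
  then have "\<Sum>X = - \<Sum>X" by (simp add: sum_negf)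
  then show ?thesis by (metis add_eq_0_iff scaleR_2 scaleR_eq_0_iff zero_neq_numeral)
qed

subsection \<open>Trace and rank of idempotent matrices\<close>

lemma matrix_vector_mult_axis:
  "(A :: 'a::comm_semiring_1^'n^'m) *v axis j 1 = column j A"
  by (simp add: matrix_vector_mult_def axis_def column_def vec_eq_iff if_distrib cong: if_cong)

text \<open>Conjugation by \<open>T\<close> preserves the trace, where the columns of
  \<open>T\<close> are a basis of the whole space extending a basis \<open>B\<close> of the column
  space.\<close>

lemma trace_idempotent_eq_dim_columns:
  fixes Q :: "'a::field^'m^'m"
  assumes idem: "Q ** Q = Q"
  shows "trace Q = of_nat (vec.dim (columns Q))"
proof -
  obtain B where B: "B \<subseteq> columns Q" "vec.independent B" "columns Q \<subseteq> vec.span B"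
      "card B = vec.dim (columns Q)"
    using vec.basis_exists by blast
  define E where "E = vec.extend_basis B"
  have E: "B \<subseteq> E" "vec.independent E" "vec.span E = UNIV"
    using vec.extend_basis_superset vec.independent_extend_basis vec.span_extend_basis B(2)
    by (auto simp: E_def)
  have finE: "finite E" using E(2) by (rule vec.finiteI_independent)
  have "card E = CARD('m)"
    using vec.dim_eq_card[of E UNIV] E vec_dim_card by (metis vec.span_UNIV)
  then obtain g where g: "bij_betw g (UNIV :: 'm set) E"
    using finE by (metis finite_same_card_bij finite)
  define T :: "'a^'m^'m" where "T = (\<chi> i j. g j $ i)"
  have col: "column j T = g j" for j by (simp add: T_def column_def)
  have "columns T = E" using g by (auto simp: columns_def col bij_betw_def)
  then obtain T' where T': "T ** T' = mat 1"
    using E(3) matrix_right_invertible_span_columns[of T] by blast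
  have T'T: "T' ** T = mat 1" using T' by (rule matrix_left_right_inverse1)
  have Tax: "T *v axis j 1 = g j" for j
    by (simp add: col matrix_vector_mult_axis)
  have T'g: "T' *v g j = axis j 1" for j
    by (simp add: Tax[symmetric] matrix_vector_mul_assoc T'T)
  \<comment> \<open>In a basis extending one of the range, \<open>Q\<close> fixes the range vectors and maps the others into
    the range, so its diagonal consists of ones and zeros.\<close>
  have diag: "(T' ** Q ** T) $ j $ j = (if g j \<in> B then 1 else 0)" for j
  proof -
    have "(T' ** Q ** T) $ j $ j = ((T' ** Q ** T) *v axis j 1) $ j"
      by (simp add: matrix_vector_mult_axis column_def)
    also have "\<dots> = (T' *v (Q *v g j)) $ j"
      by (simp only: matrix_vector_mul_assoc[symmetric] Tax)
    also have "\<dots> = (if g j \<in> B then 1 else 0)"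
    proof (cases "g j \<in> B")
      case True
      then obtain i where "g j = column i Q" using B(1) by (auto simp: columns_def)
      then have "g j = Q *v axis i 1" by (simp add: matrix_vector_mult_axis)
      then have "Q *v g j = g j" by (simp add: matrix_vector_mul_assoc idem)
      then show ?thesis using True by (simp add: T'g axis_def)
    next
      case False
      \<comment> \<open>\<open>T'\<close> reads off coordinates with respect to the basis
        \<open>g\<close>, so coordinate \<open>j\<close> vanishes on the span of basis vectors other
        than \<open>g j\<close>.\<close>
      have zero: "(T' *v y) $ j = 0" if "y \<in> vec.span B" for y
        using that
      proof (induction rule: vec.span_induct_alt)
        case base
        then show ?case by simp
      next
        case (step c x y)
        then obtain i where "x = g i" using E(1) g by (auto simp: bij_betw_def)
        moreover have "i \<noteq> j" using False step \<open>x = g i\<close> by auto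
        ultimately show ?case using step
          by (simp add: matrix_vector_right_distrib vector_scalar_commute T'g axis_def)
      qed
      have "Q *v g j \<in> vec.span B"
        using matrix_vector_mult_in_columnspace_gen[of Q "g j"] B(3) vec.span_minimal[OF B(3) vec.subspace_span]
        by blast
      then show ?thesis using zero False by simp
    qed
    finally show ?thesis .
  qed
  have "trace Q = trace (Q ** (T ** T'))" by (simp add: T')
  also have "\<dots> = trace (T' ** Q ** T)"
    by (metis matrix_mul_assoc trace_mul_sym)
  also have "\<dots> = (\<Sum>j\<in>UNIV. if g j \<in> B then 1 else 0)"
    by (simp add: trace_def diag)
  also have "\<dots> = of_nat (card {j. g j \<in> B})"
    by (simp add: sum.If_cases)
  also have "card {j. g j \<in> B} = card B"
  proof -
    have "g ` {j. g j \<in> B} = B" "inj_on g {j. g j \<in> B}"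
      using g E(1) by (auto simp: bij_betw_def inj_on_def)
    then show ?thesis by (metis card_image)
  qed
  finally show ?thesis using B(4) by simp
qed

text \<open>\<open>rank\<close> is the dimension of the row space, so the result on columns is
  applied to the transpose, which is idempotent with the same trace.\<close>

lemma trace_idempotent_eq_rank:
  fixes P :: "'a::field^'m^'m"
  assumes "P ** P = P"
  shows "trace P = of_nat (rank P)"
proof -
  have "transpose P ** transpose P = transpose P"
    using assms by (metis matrix_transpose_mul)
  from trace_idempotent_eq_dim_columns[OF this] show ?thesis
    by (simp add: row_rank_def_gen trace_def transpose_def[of P] flip: columns_transpose)
qed

subsection \<open>The orthoplex bound\<close>

definition herm_mats :: "bool \<Rightarrow> (complex^'m^'m) set" where
  "herm_mats rf = {A \<in> Fmat rf. adjoint_mat A = A}"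

lemma adjoint_mat_eq_iff: "adjoint_mat A = A \<longleftrightarrow> (\<forall>i j. cnj (A $ j $ i) = A $ i $ j)"
  by (simp add: adjoint_mat_def vec_eq_iff)

lemma subspace_herm_mats: "subspace (herm_mats rf)"
  unfolding subspace_def herm_mats_def adjoint_mat_eq_iff
  by (auto simp: Fmat_def scalars_def scaleR_conv_of_real[of _ "_ :: complex"])

lemma mat_1_in_herm_mats: "mat 1 \<in> herm_mats rf"
  by (auto simp: herm_mats_def adjoint_mat_eq_iff Fmat_def scalars_def mat_def)

lemma orth_proj_in_herm_mats: "orth_proj rf l P \<Longrightarrow> P \<in> herm_mats rf"
  by (simp add: orth_proj_def herm_mats_def)

text \<open>The set of these pairs and its mirror image cover all pairs and overlap exactly in the
  diagonal. The injection \<open>f\<close> stands in for a linear order on the index type.\<close>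

lemma card_ordered_pairs:
  fixes f :: "'m::finite \<Rightarrow> nat"
  assumes "inj f"
  shows "2 * card {(i, j). f i \<le> f j} = CARD('m)^2 + CARD('m)"
proof -
  let ?L = "{(i, j). f i \<le> f j}"
  have sw: "card (prod.swap ` ?L) = card ?L" by (intro card_image) (simp add: inj_on_def)
  have "?L \<union> prod.swap ` ?L = UNIV"
  proof (intro equalityI subsetI UNIV_I)
    fix p :: "'m \<times> 'm"
    show "p \<in> ?L \<union> prod.swap ` ?L"
      by (cases p) (auto simp: image_iff prod.swap_def)
  qed
  moreover have "?L \<inter> prod.swap ` ?L = (\<lambda>i. (i, i)) ` UNIV"
    using assms by (auto simp: inj_def)
  moreover have "card ((\<lambda>i::'m. (i, i)) ` UNIV) = CARD('m)"
    by (intro card_image) (simp add: inj_on_def)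
  moreover have "CARD('m \<times> 'm) = CARD('m)^2"
    by (simp add: card_prod power2_eq_square)
  ultimately show ?thesis
    using card_Un_Int[of ?L "prod.swap ` ?L"] sw by simp
qed

text \<open>The coordinate map \<open>\<phi>\<close> is injective on Hermitian matrices, so its
  image is measured. Over the reals the imaginary parts vanish and only pairs with
  \<open>f i \<le> f j\<close> contribute; over the complex numbers all \<open>m^2\<close>
  coordinates are allowed.\<close>

lemma dim_herm_mats: "dim (herm_mats rf :: (complex^'m::finite^'m) set) \<le> dF rf CARD('m) + 1"
proof -
  obtain f :: "'m \<Rightarrow> nat" where f: "inj f"
    using finite_imp_inj_to_nat_seg[of "UNIV :: 'm set"] by blast
  \<comment> \<open>One real coordinate per matrix entry suffices, since \<open>A\<^sub>j\<^sub>i\<close> is the conjugate of \<open>A\<^sub>i\<^sub>j\<close>.\<close>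
  define \<phi> :: "complex^'m^'m \<Rightarrow> real^'m^'m" where
    "\<phi> A = (\<chi> i j. if f i \<le> f j then Re (A $ i $ j) else Im (A $ i $ j))" for A
  have lin: "linear \<phi>"
    by (rule linearI) (auto simp: \<phi>_def vec_eq_iff)
  have ker: "A = 0" if A: "A \<in> herm_mats rf" "\<phi> A = 0" for A
  proof -
    have h: "A $ i $ j = cnj (A $ j $ i)" for i j
      using A(1) by (simp add: herm_mats_def adjoint_mat_eq_iff)
    have z: "(if f i \<le> f j then Re (A $ i $ j) else Im (A $ i $ j)) = 0" for i j
      using A(2) by (simp add: \<phi>_def vec_eq_iff)
    have "A $ i $ j = 0" for i j
    proof (cases "i = j")
      case True
      have "Im (A $ i $ i) = 0" using h[of i i] by (metis complex_cnj_complex_of_real cnj.simps(2) equal_neg_zero)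
      then show ?thesis using z[of i i] True by (simp add: complex_eq_iff)
    next
      case False
      then have "f i \<noteq> f j" using f by (auto simp: inj_def)
      then show ?thesis using z[of i j] z[of j i] h[of i j]
        by (auto simp: complex_eq_iff split: if_splits)
    qed
    then show ?thesis by (simp add: vec_eq_iff)
  qed
  have sp: "span (herm_mats rf) = herm_mats rf" by (simp add: span_eq_iff subspace_herm_mats)
  have "inj_on \<phi> (span (herm_mats rf))"
    unfolding sp
  proof (rule inj_onI)
    fix A A' assume "A \<in> herm_mats rf" "A' \<in> herm_mats rf" "\<phi> A = \<phi> A'"
    then have "A - A' = 0" using lin
      by (intro ker subspace_diff[OF subspace_herm_mats]) (simp_all add: linear_diff)
    then show "A = A'" by simp
  qed
  then have eq: "dim (\<phi> ` (herm_mats rf)) = dim (herm_mats rf :: (complex^'m^'m) set)"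
    using lin by (rule dim_image_eq[rotated])
  have m: "CARD('m) \<ge> 1" by (simp add: Suc_leI)
  show ?thesis
  proof (cases rf)
    case True
    let ?L = "{(i, j). f i \<le> f j}"
    define d :: "(real^'m^'m) set" where "d = (\<lambda>(i, j). axis i (axis j 1)) ` ?L"
    have "\<phi> ` herm_mats rf \<subseteq> {x. \<forall>b\<in>Basis. b \<notin> d \<longrightarrow> x \<bullet> b = 0}"
    proof clarsimp
      fix A :: "complex^'m^'m" and b :: "real^'m^'m"
      assume A: "A \<in> herm_mats rf" and b: "b \<in> Basis" "b \<notin> d"
      obtain i j where ij: "b = axis i (axis j 1)"
        using b(1) by (auto simp: Basis_vec_def)
      with b(2) have "\<not> f i \<le> f j" by (auto simp: d_def)
      moreover have "A $ i $ j \<in> \<real>"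
        using A True by (simp add: herm_mats_def Fmat_def scalars_def)
      ultimately show "\<phi> A \<bullet> b = 0"
        by (simp add: ij inner_axis \<phi>_def complex_is_Real_iff)
    qed
    then have "dim (\<phi> ` herm_mats rf) \<le> dim {x :: real^'m^'m. \<forall>b\<in>Basis. b \<notin> d \<longrightarrow> x \<bullet> b = 0}"
      by (rule dim_subset)
    also have "\<dots> = card d"
      by (rule dim_substandard) (auto simp: d_def Basis_vec_def)
    also have "\<dots> \<le> card ?L"
      unfolding d_def by (rule card_image_le) simp
    also have "card ?L = dF rf CARD('m) + 1"
    proof -
      obtain k where "CARD('m) = Suc k" using m by (metis Suc_le_D One_nat_def)
      then show ?thesis using card_ordered_pairs[OF f] True
        by (simp add: dF_def power2_eq_square)
    qed
    finally show ?thesis using eq by simp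
  next
    case False
    have "dim (\<phi> ` herm_mats rf) \<le> CARD('m) ^ 2"
      using dim_subset_UNIV[of "\<phi> ` herm_mats rf"] by (simp add: power2_eq_square)
    moreover have "1 \<le> CARD('m)^2" using m by (simp add: Suc_leI)
    ultimately show ?thesis using False eq by (simp add: dF_def)
  qed
qed

section \<open>Rankin's first bound applied to projections\<close>

text \<open>The inner product on \<open>complex^'m^'m\<close> is the real entrywise one. Hermitian
  symmetry of \<open>B\<close> turns it into the trace form, so Rankin's bounds apply to
  matrices.\<close>

lemma inner_eq_Re_trace:
  assumes "adjoint_mat B = B"
  shows "A \<bullet> B = Re (trace (A ** B))"
proof -
  have "Re (A $ i $ j * B $ j $ i) = A $ i $ j \<bullet> B $ i $ j" for i j
  proof -
    have "B $ j $ i = cnj (B $ i $ j)"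
      using assms by (simp add: adjoint_mat_eq_iff)
    then show ?thesis by (simp only:) (simp add: inner_complex_def)
  qed
  then show ?thesis
    by (simp add: inner_vec_def trace_def matrix_matrix_mult_def)
qed

lemma finite_pair_traces:
  assumes "finite I"
  shows "finite {Re (trace (P j ** P k)) | j k. j \<in> I \<and> k \<in> I \<and> j \<noteq> k}"
proof (rule finite_subset)
  show "{Re (trace (P j ** P k)) | j k. j \<in> I \<and> k \<in> I \<and> j \<noteq> k} \<subseteq>
      (\<lambda>(j, k). Re (trace (P j ** P k))) ` (I \<times> I)"
    by auto
qed (simp add: assms)

lemma orthoplex_bound:
  fixes P :: "'i \<Rightarrow> complex^'m::finite^'m"
  assumes fin: "finite I" and P: "\<And>j. j \<in> I \<Longrightarrow> orth_proj rf l (P j)"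
    and card: "card I > dF rf CARD('m) + 1"
  shows "real l ^ 2 / real CARD('m) \<le> max_tr I P"
proof (rule ccontr)
  assume less: "\<not> ?thesis"
  let ?m = "real CARD('m)"
  let ?T = "{Re (trace (P j ** P k)) | j k. j \<in> I \<and> k \<in> I \<and> j \<noteq> k}"
  have finT: "finite ?T" by (rule finite_pair_traces[OF fin])
  have tr: "Re (trace (P j ** P k)) < (real l)\<^sup>2 / ?m" if "j \<in> I" "k \<in> I" "j \<noteq> k" for j k
  proof -
    have "Re (trace (P j ** P k)) \<le> max_tr I P"
      unfolding max_tr_def by (rule Max_ge[OF finT]) (use that in blast)
    with less show ?thesis by simp
  qed
  have adj1: "adjoint_mat (mat 1 :: complex^'m^'m) = mat 1"
    using mat_1_in_herm_mats by (auto simp: herm_mats_def)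
  have PI: "P j \<bullet> mat 1 = real l" if "j \<in> I" for j
    using P[OF that] trace_idempotent_eq_rank[of "P j"]
    by (simp add: inner_eq_Re_trace[OF adj1] orth_proj_def)
  have II: "(mat 1 :: complex^'m^'m) \<bullet> mat 1 = ?m"
    by (simp add: inner_eq_Re_trace[OF adj1] trace_I)
  \<comment> \<open>Each projection has trace \<open>l\<close> and the identity has trace
    \<open>m\<close>, so this shift makes \<open>v j\<close> traceless, that is, orthogonal to
    \<open>mat 1\<close>.\<close>
  define v where "v j = P j - (real l / ?m) *\<^sub>R mat 1" for j
  have vI: "v j \<bullet> mat 1 = 0" if "j \<in> I" for j
    using PI[OF that] by (simp add: v_def inner_diff_left II)
  have vv: "v j \<bullet> v k < 0" if "j \<in> I" "k \<in> I" "j \<noteq> k" for j k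
  proof -
    have "v j \<bullet> v k = v j \<bullet> P k"
      using vI[OF that(1)] by (subst (2) v_def) (simp add: inner_diff_right)
    also have "\<dots> = P j \<bullet> P k - (real l)\<^sup>2 / ?m"
      using PI[OF that(2)] by (simp add: v_def inner_diff_left inner_commute[of "mat 1"] power2_eq_square)
    also have "\<dots> < 0"
      using tr[OF that] P[OF that(2)] by (simp add: inner_eq_Re_trace orth_proj_def)
    finally show ?thesis .
  qed
  have inj: "inj_on v I"
    by (rule inj_onI) (metis vv inner_ge_zero not_le)
  have "card (v ` I) \<le> dim (v ` I) + 1"
    using fin vv by (intro card_le_dim_if_inner_neg) (auto simp: pairwise_def)
  \<comment> \<open>The \<open>+ 1\<close> of Rankin's bound is absorbed by the direction of the
    identity, which is orthogonal to all \<open>v j\<close>.\<close>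
  also have "\<dots> = dim (insert (mat 1) (v ` I))"
    using vI II by (subst dim_orthogonal_insert) auto
  also have "\<dots> \<le> dim (herm_mats rf :: (complex^'m^'m) set)"
    by (rule dim_subset)
       (auto simp: v_def mat_1_in_herm_mats orth_proj_in_herm_mats[OF P]
          intro!: subspace_diff subspace_scale subspace_herm_mats)
  also have "\<dots> \<le> dF rf CARD('m) + 1" by (rule dim_herm_mats)
  finally show False using card by (simp add: card_image[OF inj])
qed

subsection \<open>Coordinate projections\<close>

lemma matrix_mult_sum_left:
  fixes A :: "'b \<Rightarrow> 'a::semiring_1^'n^'m" and C :: "'a^'p^'n"
  shows "(\<Sum>x\<in>X. A x) ** C = (\<Sum>x\<in>X. A x ** C)"
  by (induction X rule: infinite_finite_induct) (simp_all add: matrix_matrix_mult_def vec_eq_iff distrib_right sum.distrib)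

lemma matrix_mult_sum_right:
  fixes A :: "'b \<Rightarrow> 'a::semiring_1^'n^'m" and C :: "'a^'m^'p"
  shows "C ** (\<Sum>x\<in>X. A x) = (\<Sum>x\<in>X. C ** A x)"
  by (induction X rule: infinite_finite_induct) (simp_all add: matrix_add_ldistrib)

lemma trace_sum:
  fixes A :: "'b \<Rightarrow> 'a::comm_semiring_1^'m^'m"
  shows "trace (\<Sum>x\<in>X. A x) = (\<Sum>x\<in>X. trace (A x))"
  unfolding trace_def by (subst sum.swap) simp

lemma trace_outer_mult: "trace (outer a ** outer b) = of_real ((cmod (cinner a b))\<^sup>2)"
proof -
  have "trace (outer a ** outer b) = (\<Sum>i\<in>UNIV. \<Sum>k\<in>UNIV. (a $ i * cnj (b $ i)) * cnj (a $ k * cnj (b $ k)))"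
    by (simp add: trace_def matrix_matrix_mult_def outer_def mult_ac)
  also have "\<dots> = cinner a b * cnj (cinner a b)"
    by (simp add: cinner_def sum_product)
  finally show ?thesis by (simp add: complex_norm_square[symmetric])
qed

lemma Re_trace_coord_proj_mult:
  "Re (trace (coord_proj b J ** coord_proj b' J')) =
     (\<Sum>j\<in>J. \<Sum>j'\<in>J'. (cmod (cinner (b j) (b' j')))\<^sup>2)"
  unfolding coord_proj_def
  by (subst sum.swap)
     (simp add: matrix_mult_sum_left matrix_mult_sum_right trace_sum trace_outer_mult del: of_real_power)

lemma Re_trace_coord_proj_same:
  fixes b :: "'m::finite \<Rightarrow> complex^'m"
  assumes "onb rf b"
  shows "Re (trace (coord_proj b J ** coord_proj b J')) = real (card (J \<inter> J'))"
proof -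
  have "(cmod (cinner (b j) (b j')))\<^sup>2 = (if j = j' then 1 else 0)" for j j'
    using assms by (simp add: onb_def)
  then show ?thesis
    by (simp add: Re_trace_coord_proj_mult sum.If_cases)
qed

lemma Re_trace_coord_proj_unbiased:
  fixes b b' :: "'m::finite \<Rightarrow> complex^'m"
  assumes "mutually_unbiased b b'"
  shows "Re (trace (coord_proj b J ** coord_proj b' J')) = real (card J) * real (card J') / real CARD('m)"
  using assms by (simp add: Re_trace_coord_proj_mult mutually_unbiased_def)

section \<open>Resolution of the identity and norms of projected vectors\<close>

text \<open>Orthonormality says \<open>V ** U = mat 1\<close> with the basis vectors as columns of
  \<open>U\<close>. For square matrices this gives \<open>U ** V = mat 1\<close>, which is
  completeness.\<close>

lemma sum_outer_onb:
  fixes b :: "'m::finite \<Rightarrow> complex^'m"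
  assumes "onb rf b"
  shows "(\<Sum>j\<in>UNIV. outer (b j)) = mat 1"
proof -
  define U :: "complex^'m^'m" where "U = (\<chi> i j. b j $ i)"
  define V :: "complex^'m^'m" where "V = (\<chi> i j. cnj (b i $ j))"
  have "V ** U = (\<chi> i j. cinner (b j) (b i))"
    by (simp add: U_def V_def matrix_matrix_mult_def cinner_def mult_ac)
  also have "\<dots> = mat 1"
    using assms by (simp add: onb_def mat_def vec_eq_iff)
  finally have "U ** V = mat 1" by (rule matrix_left_right_inverse1)
  moreover have "U ** V = (\<Sum>j\<in>UNIV. outer (b j))"
    by (simp add: U_def V_def matrix_matrix_mult_def outer_def vec_eq_iff)
  ultimately show ?thesis by simp
qed

lemma cinner_adjoint: "cinner (A *v x) y = cinner x (adjoint_mat A *v y)"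
  unfolding cinner_def adjoint_mat_def matrix_vector_mult_def
  by (simp add: sum_distrib_left sum_distrib_right) (subst sum.swap, simp add: mult_ac)

lemma norm_square_eq_cinner: "(norm x)\<^sup>2 = Re (cinner x x)"
  by (simp add: power2_norm_eq_inner inner_vec_def cinner_def inner_complex_def)

text \<open>The right-hand side is linear in \<open>P\<close>, so the frame sum reduces to the sum
  of the projections.\<close>

lemma norm_square_orth_proj:
  assumes "orth_proj rf l P"
  shows "(norm (P *v x))\<^sup>2 = Re (cinner (P *v x) x)"
proof -
  have "cinner (P *v (P *v x)) x = cinner (P *v x) (P *v x)"
    using assms by (simp add: cinner_adjoint orth_proj_def)
  then show ?thesis
    using assms by (simp add: norm_square_eq_cinner matrix_vector_mul_assoc orth_proj_def)
qed

lemma cinner_sum_left: "cinner (\<Sum>x\<in>X. f x) y = (\<Sum>x\<in>X. cinner (f x) y)"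
  unfolding cinner_def by (subst sum.swap) (simp add: sum_distrib_right)

lemma matrix_vector_mult_sum_left:
  fixes A :: "'b \<Rightarrow> 'a::semiring_1^'n^'m"
  shows "(\<Sum>x\<in>X. A x) *v y = (\<Sum>x\<in>X. A x *v y)"
  by (induction X rule: infinite_finite_induct) (simp_all add: matrix_vector_mult_add_rdistrib)

section \<open>Tightness from maximally orthoplectic collections\<close>

lemma card_containing_const:
  fixes S :: "'m::finite set set"
  assumes sizes: "\<And>J. J \<in> S \<Longrightarrow> card J = l"
    and max: "max_orthoplectic_coll l S" and ne: "S \<noteq> {}"
  shows "real (card {J \<in> S. i \<in> J}) = real (card S) * real l / real CARD('m)"
proof -
  let ?m = "real CARD('m)"
  define u :: "'m set \<Rightarrow> real^'m" where "u J = (\<chi> i. indicator J i - real l / ?m)" for J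
  have u1: "u J \<bullet> 1 = 0" if "J \<in> S" for J
    using sizes[OF that] by (simp add: u_def inner_vec_def sum_subtractf indicator_def sum.If_cases)
  have uu: "u J \<bullet> u J' = real (card (J \<inter> J')) - (real l)\<^sup>2 / ?m" if "J \<in> S" "J' \<in> S" for J J'
  proof -
    have "u J \<bullet> u J' = (\<Sum>i\<in>UNIV. u J $ i * indicator J' i) - (real l / ?m) * (u J \<bullet> 1)"
      by (simp add: u_def[of J'] inner_vec_def right_diff_distrib sum_subtractf sum_distrib_left sum_divide_distrib mult_ac)
    also have "\<dots> = (\<Sum>i\<in>UNIV. indicator (J \<inter> J') i) - (real l / ?m) * (\<Sum>i\<in>UNIV. indicator J' i)"
    proof -
      have "u J $ i * indicator J' i = indicator (J \<inter> J') i - (real l / ?m) * indicator J' i" for i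
        by (simp add: u_def left_diff_distrib indicator_inter_arith)
      then show ?thesis by (simp only: u1[OF that(1)] sum_subtractf sum_distrib_left mult_zero_right diff_zero)
    qed
    also have "\<dots> = real (card (J \<inter> J')) - (real l)\<^sup>2 / ?m"
      using sizes[OF that(2)] by (simp add: indicator_def sum.If_cases power2_eq_square Int_def)
    finally show ?thesis .
  qed
  have inj: "inj_on u S"
  proof (rule inj_onI)
    fix J J' assume "u J = u J'"
    then have "indicator J i = (indicator J' i :: real)" for i
      by (simp add: u_def vec_eq_iff)
    then show "J = J'" by (simp add: indicator_def set_eq_iff of_bool_eq_iff)
  qed
  have cS: "card S = 2 * (CARD('m) - 1)" using max by (simp add: max_orthoplectic_coll_def)
  have norm: "norm x = sqrt (real l - (real l)\<^sup>2 / ?m)" if "x \<in> u ` S" for x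
    using that uu sizes by (auto simp: norm_eq_sqrt_inner)
  \<comment> \<open>All \<open>u J\<close> have the same norm, so if one vanishes all do, and
    injectivity leaves at most one member. But \<open>card S\<close> is even, so \<open>S\<close>
    would be empty.\<close>
  have "0 \<notin> u ` S"
  proof
    assume "0 \<in> u ` S"
    then have "sqrt (real l - (real l)\<^sup>2 / ?m) = 0" using norm by fastforce
    then have "u ` S \<subseteq> {0}" using norm by auto
    then have "card (u ` S) \<le> card {0 :: real^'m}" by (intro card_mono) auto
    then have "card S \<le> 1" by (simp add: card_image[OF inj])
    then have "card S = 0" using cS by presburger
    then show False using ne by simp
  qed
  moreover have "pairwise (\<lambda>x y. x \<bullet> y \<le> 0) (u ` S)"
    using max by (auto simp: pairwise_def uu max_orthoplectic_coll_def cohesive_def)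
  moreover have "2 * dim (u ` S) \<le> card (u ` S)"
  proof -
    \<comment> \<open>Orthogonality to the all-ones vector confines the \<open>u J\<close> to
      dimension \<open>m - 1\<close>, which makes \<open>card S\<close> extremal.\<close>
    have "Suc (dim (u ` S)) = dim (insert 1 (u ` S))"
      using u1 by (intro dim_orthogonal_insert[symmetric]) (auto simp: vec_eq_iff)
    also have "\<dots> \<le> CARD('m)" using dim_subset_UNIV[of "insert 1 (u ` S)"] by simp
    finally show ?thesis using cS by (simp add: card_image[OF inj])
  qed
  ultimately have "\<Sum> (u ` S) = 0"
    using norm by (intro sum_eq_0_if_card_extremal) auto
  then have "(\<Sum>J\<in>S. u J) $ i = 0" by (simp add: sum.reindex[OF inj])
  then have "(\<Sum>J\<in>S. indicator J i) = real (card S) * (real l / ?m)"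
    by (simp add: u_def sum_subtractf)
  moreover have "(\<Sum>J\<in>S. indicator J i) = real (card {J \<in> S. i \<in> J})"
    by (simp add: indicator_def sum.If_cases Int_def)
  ultimately show ?thesis by simp
qed

text \<open>Exchanging the sums counts, for each basis vector, the members of \<open>S\<close>
  containing its index. These counts agree, leaving a multiple of the resolution of the
  identity.\<close>

lemma sum_coord_proj_max_orthoplectic:
  fixes S :: "'m::finite set set"
  assumes "\<And>J. J \<in> S \<Longrightarrow> card J = l" "max_orthoplectic_coll l S" "S \<noteq> {}" "onb rf b"
  shows "(\<Sum>J\<in>S. coord_proj b J) = (real (card S) * real l / real CARD('m)) *\<^sub>R mat 1"
proof -
  have "(\<Sum>J\<in>S. coord_proj b J) = (\<Sum>J\<in>S. \<Sum>j\<in>UNIV. if j \<in> J then outer (b j) else 0)"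
    by (simp add: coord_proj_def sum.If_cases)
  also have "\<dots> = (\<Sum>j\<in>UNIV. \<Sum>J\<in>S. if j \<in> J then outer (b j) else 0)"
    by (rule sum.swap)
  also have "\<dots> = (\<Sum>j\<in>UNIV. real (card {J \<in> S. j \<in> J}) *\<^sub>R outer (b j))"
    by (simp add: sum.If_cases Int_def sum_constant_scaleR del: sum_constant)
  also have "\<dots> = (real (card S) * real l / real CARD('m)) *\<^sub>R (\<Sum>j\<in>UNIV. outer (b j))"
    by (simp add: card_containing_const[OF assms(1-3)] scaleR_sum_right)
  finally show ?thesis by (simp add: sum_outer_onb[OF assms(4)])
qed

lemma tight_fusion_frame_max_orthoplectic:
  fixes S :: "'m::finite set set"
  assumes sizes: "\<And>J. J \<in> S \<Longrightarrow> card J = l"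
    and max: "max_orthoplectic_coll l S" and ne: "S \<noteq> {}"
    and onb: "\<And>k. k \<in> K \<Longrightarrow> onb rf (B k)"
    and ff: "fusion_frame rf n l (K \<times> S) (\<lambda>(k, J). coord_proj (B k) J)"
  shows "tight_fusion_frame rf n l (K \<times> S) (\<lambda>(k, J). coord_proj (B k) J)"
proof -
  let ?P = "\<lambda>(k, J). coord_proj (B k) J"
  define c where "c = real (card S) * real l / real CARD('m)"
  define C where "C = real (card K) * c"
  have proj: "orth_proj rf l (?P p)" if "p \<in> K \<times> S" for p
    using ff that unfolding fusion_frame_def by blast
  have eq: "(\<Sum>p\<in>K \<times> S. (norm (?P p *v x))\<^sup>2) = C * (norm x)\<^sup>2" for x
  proof -
    have "(\<Sum>p\<in>K \<times> S. (norm (?P p *v x))\<^sup>2) = (\<Sum>p\<in>K \<times> S. Re (cinner (?P p *v x) x))"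
      by (intro sum.cong refl norm_square_orth_proj[OF proj])
    also have "\<dots> = Re (cinner ((\<Sum>p\<in>K \<times> S. ?P p) *v x) x)"
      by (simp add: cinner_sum_left matrix_vector_mult_sum_left)
    also have "(\<Sum>p\<in>K \<times> S. ?P p) = (\<Sum>k\<in>K. \<Sum>J\<in>S. coord_proj (B k) J)"
      by (simp add: sum.cartesian_product)
    also have "\<dots> = C *\<^sub>R mat 1"
      using sum_coord_proj_max_orthoplectic[OF sizes max ne onb]
      by (simp add: c_def C_def sum_constant_scaleR del: sum_constant)
    also have "(C *\<^sub>R mat 1) *v x = C *\<^sub>R (mat 1 *v x)"
      by (simp add: vec_eq_iff matrix_vector_mult_def scaleR_sum_right)
    also have "Re (cinner (C *\<^sub>R (mat 1 *v x)) x) = C * Re (cinner x x)"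
      by (simp add: cinner_def sum_distrib_left algebra_simps)
    finally show ?thesis by (simp add: norm_square_eq_cinner)
  qed
  \<comment> \<open>Positivity of \<open>C\<close> comes from the lower frame bound, tested on a
    unit coordinate vector, which lies in \<open>Fvec rf\<close> for either scalar field.\<close>
  obtain A D where A: "A > 0"
    and AD: "\<forall>x\<in>(Fvec rf :: (complex^'m) set). A * (norm x)\<^sup>2 \<le> C * (norm x)\<^sup>2 \<and> C * (norm x)\<^sup>2 \<le> D * (norm x)\<^sup>2"
    using ff unfolding fusion_frame_def eq by blast
  define e :: "complex^'m" where "e = axis undefined 1"
  have "e \<in> Fvec rf"
    by (simp add: e_def Fvec_def scalars_def axis_def)
  moreover have "norm e = 1"
    by (simp add: e_def norm_eq_sqrt_inner inner_axis_axis)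
  ultimately have "A \<le> C" using AD by force
  then have "C > 0" using A by simp
  then show ?thesis using ff eq unfolding tight_fusion_frame_def by (intro conjI exI[of _ C]) auto
qed

section \<open>Attaining the orthoplex bound, and the maximal case\<close>

theorem theorem3p11:
  fixes rf :: bool and l n :: nat
    and S :: "'m::finite set set"
    and K :: "'k set" and B :: "'k \<Rightarrow> 'm \<Rightarrow> complex^'m"
  assumes sizes: "\<forall>J\<in>S. card J = l"
    and coh: "cohesive (real l ^ 2 / real CARD('m)) S"
    and mub: "MUB_set rf K B"
    and big: "card K * card S > dF rf CARD('m) + 1"
    and n_def: "n = card K * card S"
    and ff: "fusion_frame rf n l (K \<times> S) (\<lambda>(k, J). coord_proj (B k) J)"
  shows "orthoplex_bound_achieving rf n l (K \<times> S) (\<lambda>(k, J). coord_proj (B k) J)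
    \<and> (max_orthoplectic_coll l S \<and> real (card K) = kF rf CARD('m) \<longrightarrow>
         tight_fusion_frame rf n l (K \<times> S) (\<lambda>(k, J). coord_proj (B k) J)
       \<and> maximal_orthoplectic rf n l (K \<times> S) (\<lambda>(k, J). coord_proj (B k) J))"
proof -
  let ?P = "\<lambda>(k, J). coord_proj (B k) J"
  let ?b = "real l ^ 2 / real CARD('m)"
  let ?T = "{Re (trace (?P p ** ?P q)) | p q. p \<in> K \<times> S \<and> q \<in> K \<times> S \<and> p \<noteq> q}"
  have fin: "finite (K \<times> S)" and card: "card (K \<times> S) = n"
    and proj: "\<And>p. p \<in> K \<times> S \<Longrightarrow> orth_proj rf l (?P p)"
    using ff unfolding fusion_frame_def by blast+
  have tr: "Re (trace (?P p ** ?P q)) \<le> ?b" if pq: "p \<in> K \<times> S" "q \<in> K \<times> S" "p \<noteq> q" for p q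
  proof -
    obtain k J k' J' where [simp]: "p = (k, J)" "q = (k', J')" by (cases p, cases q)
    show ?thesis
    proof (cases "k = k'")
      case True
      then have "onb rf (B k)" "J \<noteq> J'" using mub pq by (auto simp: MUB_set_def)
      then show ?thesis
        using coh pq True by (simp add: Re_trace_coord_proj_same cohesive_def)
    next
      case False
      then have "mutually_unbiased (B k) (B k')" using mub pq by (auto simp: MUB_set_def)
      then show ?thesis
        using sizes pq by (simp add: Re_trace_coord_proj_unbiased power2_eq_square)
    qed
  qed
  have "finite ?T" by (rule finite_pair_traces[OF fin])
  \<comment> \<open>\<open>Max\<close> is meaningful only on a nonempty set; more than
    \<open>dF + 1\<close> index pairs guarantee two distinct ones.\<close>
  moreover have "?T \<noteq> {}"
  proof -
    have "\<not> card (K \<times> S) \<le> Suc 0" using big card n_def by simp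
    then obtain p q where "p \<in> K \<times> S" "q \<in> K \<times> S" "p \<noteq> q"
      using card_le_Suc0_iff_eq[OF fin] by blast
    then show ?thesis by blast
  qed
  ultimately have "max_tr (K \<times> S) ?P \<le> ?b"
    unfolding max_tr_def using tr by (intro Max.boundedI) blast+
  moreover have "?b \<le> max_tr (K \<times> S) ?P"
    using orthoplex_bound[OF fin proj] big card n_def by simp
  ultimately have max: "max_tr (K \<times> S) ?P = ?b" by simp
  have "grassmannian rf n l (K \<times> S) ?P"
    unfolding grassmannian_def max
  proof (intro conjI ff allI impI)
    fix Q :: "nat \<Rightarrow> complex^'m^'m"
    assume "fusion_frame rf n l {..<n} Q"
    then show "?b \<le> max_tr {..<n} Q"
      using big n_def by (intro orthoplex_bound) (auto simp: fusion_frame_def)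
  qed
  then have oba: "orthoplex_bound_achieving rf n l (K \<times> S) ?P"
    using big n_def max by (simp add: orthoplex_bound_achieving_def)
  have "tight_fusion_frame rf n l (K \<times> S) ?P \<and> maximal_orthoplectic rf n l (K \<times> S) ?P"
    if S: "max_orthoplectic_coll l S" and K: "real (card K) = kF rf CARD('m)"
  proof
    have "S \<noteq> {}" using big by auto
    then show "tight_fusion_frame rf n l (K \<times> S) ?P"
      using sizes mub ff by (intro tight_fusion_frame_max_orthoplectic S) (auto simp: MUB_set_def)
    have "n = 2 * dF rf CARD('m)"
    proof -
      \<comment> \<open>Writing \<open>m = t + 1\<close> removes the truncated subtraction in
        \<open>m - 1\<close>.\<close>
      obtain t where t: "CARD('m) = Suc t" by (metis Suc_le_D One_nat_def Suc_leI zero_less_card_finite)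
      have n: "n = card K * (2 * t)" using S n_def t by (simp add: max_orthoplectic_coll_def)
      show ?thesis
      proof (cases rf)
        case True
        \<comment> \<open>Doubling clears the half in \<open>kF\<close>, giving an equation of
          naturals. The division by 2 in \<open>dF\<close> is exact because \<open>t\<close> and
          \<open>t + 3\<close> have opposite parity.\<close>
        then have "real (2 * card K) = real (t + 3)" using K t by (simp add: kF_def)
        then have "2 * card K = t + 3" by (simp only: of_nat_eq_iff)
        then have "n = (t + 3) * t" using n by (metis mult.assoc mult.commute)
        then show ?thesis using True t by (simp add: dF_def algebra_simps)
      next
        case False
        then have "real (card K) = real (t + 2)" using K t by (simp add: kF_def)
        then have "card K = t + 2" by (simp only: of_nat_eq_iff)
        then show ?thesis using False n t by (simp add: dF_def power2_eq_square)
      qed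
    qed
    then show "maximal_orthoplectic rf n l (K \<times> S) ?P"
      using oba by (simp add: maximal_orthoplectic_def)
  qed
  with oba show ?thesis by blast
qed

end
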